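(* Let $\Sigma$ be a two-dimensional manifold embedded in a Riemannian manifold $(M,\bar g)$ of dimension $m$, and let $\rho$ be a non-vanishing density on $\Sigma$. Define $\mathcal{J}_M(X)=(\rho/\sqrt{g})\,\mathcal{P}(X)$ for all $X\in TM$ (at points of $\Sigma$). Then: (1) $\mathcal{J}_M(X)=\mathcal{J}(X)$ for all $X\in T\Sigma$; (2) $-\mathcal{J}_M^2(X)=g^{ab}\,\bar g(X,e_a)\,e_b$ is the (orthogonal) projection of $X\in TM$ onto $T\Sigma$.
   Context: Setting: $x^1,\dots,x^m$ are local coordinates on $M$, $u^1,u^2$ local coordinates on $\Sigma$, and the embedding is given by functions $x^i(u^1,u^2)$. Indices $i,j,k$ run over $1,\dots,m$; $a,b,c$ over $1,2$; repeated indices are summed. $T\Sigma\subset TM$ has basis $e_a=(\partial_a x^i)\partial_i$; $g_{ab}=\bar g(e_a,e_b)$ is the induced metric, $g=\det(g_{ab})$, $g^{ab}$ its inverse. $\rho$ is a non-vanishing density on $\Sigma$ (under coordinate change $\tilde\rho(v)=|\partial(u^1,u^2)/\partial(v^1,v^2)|\,\rho(u(v))$), and the Poisson bracket on $C^\infty(\Sigma)$ is $\{f,h\}=\frac1\rho\varepsilon^{ab}(\partial_a f)(\partial_b h)$ with $\varepsilon^{ab}$ antisymmetric, $\varepsilon^{12}=1$. The map $\mathcal{P}:TM\to TM$ is $\mathcal{P}(X)=\mathcal{P}^{ik}\bar g_{kj}X^j\partial_i$ with $\mathcal{P}^{ij}=\{x^i,x^j\}$. $\mathcal{J}$ is the complex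 structure on $\Sigma$ associated to the induced metric: $\mathcal{J}(X)=\frac{1}{\sqrt g}\varepsilon^{ac}g_{cb}X^b e_a$ for $X=X^be_b\in T\Sigma$. *)

theory Defs
  imports "HOL-Analysis.Analysis"
begin

definition pd :: "'n \<Rightarrow> (real^'n::finite \<Rightarrow> 'b::real_normed_vector) \<Rightarrow> real^'n \<Rightarrow> 'b" where
  "pd i f y = frechet_derivative f (at y) (axis i 1)"

primrec Ck_on :: "nat \<Rightarrow> (real^'n::finite) set \<Rightarrow> (real^'n \<Rightarrow> 'b::real_normed_vector) \<Rightarrow> bool" where
  "Ck_on 0 U f \<longleftrightarrow> continuous_on U f"
| "Ck_on (Suc k) U f \<longleftrightarrow> f differentiable_on U \<and> (\<forall>i. Ck_on k U (pd i f))"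

text \<open>Only used for open \<open>U\<close>: \<^const>\<open>pd\<close> takes derivatives in the ambient space.\<close>

definition smooth_on :: "(real^'n::finite) set \<Rightarrow> (real^'n \<Rightarrow> 'b::real_normed_vector) \<Rightarrow> bool" where
  "smooth_on U f \<longleftrightarrow> (\<forall>k. Ck_on k U f)"

text \<open>A chart is a domain together with a coordinate map; only the values of the
  coordinate map on the domain matter.\<close>

type_synonym ('p, 'n) chart = "'p set \<times> ('p \<Rightarrow> real^'n)"

definition in_coords :: "('p, 'n::finite) chart \<Rightarrow> ('p \<Rightarrow> 'b) \<Rightarrow> real^'n \<Rightarrow> 'b" where
  "in_coords c f = f \<circ> inv_into (fst c) (snd c)"

definition chart_on :: "'p topology \<Rightarrow> ('p, 'n::finite) chart \<Rightarrow> bool" where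
  "chart_on M c \<longleftrightarrow> openin M (fst c) \<and> open (snd c ` fst c) \<and>
     homeomorphic_map (subtopology M (fst c)) (top_of_set (snd c ` fst c)) (snd c)"

definition smooth_manifold :: "'p topology \<Rightarrow> ('p, 'n::finite) chart set \<Rightarrow> bool" where
  "smooth_manifold M A \<longleftrightarrow>
     Hausdorff_space M \<and> second_countable M \<and>
     (\<forall>c\<in>A. chart_on M c) \<and> (\<Union>c\<in>A. fst c) = topspace M \<and>
     (\<forall>c\<in>A. \<forall>d\<in>A. smooth_on (snd c ` (fst c \<inter> fst d)) (in_coords c (snd d)))"

definition chart_at :: "('p, 'n::finite) chart set \<Rightarrow> 'p \<Rightarrow> ('p, 'n) chart \<Rightarrow> bool" where
  "chart_at A p c \<longleftrightarrow> c \<in> A \<and> p \<in> fst c"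

text \<open>The matrix \<open>\<partial>d\<^sup>i/\<partial>c\<^sup>j\<close> at \<open>p\<close> of the change of coordinates from \<open>c\<close> to \<open>d\<close>.\<close>

definition coord_change :: "('p, 'n::finite) chart \<Rightarrow> ('p, 'n) chart \<Rightarrow> 'p \<Rightarrow> real^'n^'n" where
  "coord_change c d p = jacobian (in_coords c (snd d)) (at (snd c p))"

definition coord_deriv :: "('p, 'n::finite) chart \<Rightarrow> 'n \<Rightarrow> ('p \<Rightarrow> real) \<Rightarrow> 'p \<Rightarrow> real" where
  "coord_deriv c a f p = pd a (in_coords c f) (snd c p)"

text \<open>Tensors and densities are given by their components: \<open>G c p\<close> is the matrix
  \<open>g\<^sub>i\<^sub>j\<close> at \<open>p\<close> in the chart \<open>c\<close>, and \<open>\<rho> c p\<close> is the coefficient of the density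
  at \<open>p\<close> in the chart \<open>c\<close>.\<close>

definition riemannian_metric ::
  "('p, 'm::finite) chart set \<Rightarrow> (('p, 'm) chart \<Rightarrow> 'p \<Rightarrow> real^'m^'m) \<Rightarrow> bool" where
  "riemannian_metric A G \<longleftrightarrow>
     (\<forall>c\<in>A. smooth_on (snd c ` fst c) (in_coords c (G c))) \<and>
     (\<forall>c\<in>A. \<forall>p\<in>fst c. transpose (G c p) = G c p \<and> (\<forall>v. v \<noteq> 0 \<longrightarrow> v \<bullet> (G c p *v v) > 0)) \<and>
     (\<forall>c\<in>A. \<forall>d\<in>A. \<forall>p\<in>fst c \<inter> fst d.
        G d p = transpose (coord_change d c p) ** G c p ** coord_change d c p)"

definition nonvanishing_density ::
  "('p, 'n::finite) chart set \<Rightarrow> (('p, 'n) chart \<Rightarrow> 'p \<Rightarrow> real) \<Rightarrow> bool" where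
  "nonvanishing_density A \<rho> \<longleftrightarrow>
     (\<forall>c\<in>A. smooth_on (snd c ` fst c) (in_coords c (\<rho> c))) \<and>
     (\<forall>c\<in>A. \<forall>p\<in>fst c. \<rho> c p \<noteq> 0) \<and>
     (\<forall>c\<in>A. \<forall>d\<in>A. \<forall>p\<in>fst c \<inter> fst d. \<rho> d p = \<bar>det (coord_change d c p)\<bar> * \<rho> c p)"

definition smooth_embedding ::
  "'s topology \<Rightarrow> ('s, 'n::finite) chart set \<Rightarrow> 'p topology \<Rightarrow> ('p, 'm::finite) chart set
     \<Rightarrow> ('s \<Rightarrow> 'p) \<Rightarrow> bool" where
  "smooth_embedding S A M B \<iota> \<longleftrightarrow>
     embedding_map S M \<iota> \<and>
     (\<forall>u\<in>A. \<forall>x\<in>B.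
        smooth_on (snd u ` (fst u \<inter> \<iota> -` fst x)) (in_coords u (snd x \<circ> \<iota>)) \<and>
        (\<forall>p \<in> fst u \<inter> \<iota> -` fst x.
           inj (frechet_derivative (in_coords u (snd x \<circ> \<iota>)) (at (snd u p)))))"

text \<open>In the following, \<open>u\<close> is a chart of the surface around \<open>p\<close>, \<open>x\<close> is a chart of the
  ambient manifold around \<open>\<iota> p\<close>, and a vector tangent to the ambient manifold at \<open>\<iota> p\<close> is
  given by its components \<open>X\<^sup>i\<close> with respect to the basis \<open>\<partial>\<^sub>i\<close> belonging to \<open>x\<close>.\<close>

text \<open>The symbol \<open>\<epsilon>\<^sup>a\<^sup>b\<close> refers to the chosen chart \<open>u\<close>. Since a density transforms with the
  absolute value of the Jacobian, the bracket and the complex structure both change sign under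
  an orientation-reversing change of \<open>u\<close>.\<close>

definition eps :: "2 \<Rightarrow> 2 \<Rightarrow> real" where
  "eps a b = (if a = 1 \<and> b = 2 then 1 else if a = 2 \<and> b = 1 then - 1 else 0)"

definition poisson_bracket ::
  "(('s, 2) chart \<Rightarrow> 's \<Rightarrow> real) \<Rightarrow> ('s, 2) chart \<Rightarrow> ('s \<Rightarrow> real) \<Rightarrow> ('s \<Rightarrow> real) \<Rightarrow> 's \<Rightarrow> real" where
  "poisson_bracket \<rho> u f h p =
     1 / \<rho> u p * (\<Sum>a\<in>UNIV. \<Sum>b\<in>UNIV. eps a b * coord_deriv u a f p * coord_deriv u b h p)"

definition metric_at ::
  "(('p, 'm::finite) chart \<Rightarrow> 'p \<Rightarrow> real^'m^'m) \<Rightarrow> ('p, 'm) chart \<Rightarrow> 'p \<Rightarrow> real^'m \<Rightarrow> real^'m \<Rightarrow> real" where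
  "metric_at G x q X Y = (\<Sum>i\<in>UNIV. \<Sum>j\<in>UNIV. G x q $ i $ j * X $ i * Y $ j)"

definition emb_coord :: "('s \<Rightarrow> 'p) \<Rightarrow> ('p, 'm::finite) chart \<Rightarrow> 'm \<Rightarrow> 's \<Rightarrow> real" where
  "emb_coord \<iota> x i p = snd x (\<iota> p) $ i"

definition frame ::
  "('s \<Rightarrow> 'p) \<Rightarrow> ('s, 2) chart \<Rightarrow> ('p, 'm::finite) chart \<Rightarrow> 's \<Rightarrow> 2 \<Rightarrow> real^'m" where
  "frame \<iota> u x p a = (\<chi> i. coord_deriv u a (emb_coord \<iota> x i) p)"

definition tangent_plane ::
  "('s \<Rightarrow> 'p) \<Rightarrow> ('s, 2) chart \<Rightarrow> ('p, 'm::finite) chart \<Rightarrow> 's \<Rightarrow> (real^'m) set" where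
  "tangent_plane \<iota> u x p = span (range (frame \<iota> u x p))"

definition induced_metric ::
  "(('p, 'm::finite) chart \<Rightarrow> 'p \<Rightarrow> real^'m^'m) \<Rightarrow> ('s \<Rightarrow> 'p) \<Rightarrow> ('s, 2) chart
     \<Rightarrow> ('p, 'm) chart \<Rightarrow> 's \<Rightarrow> real^2^2" where
  "induced_metric G \<iota> u x p =
     (\<chi> a b. metric_at G x (\<iota> p) (frame \<iota> u x p a) (frame \<iota> u x p b))"

definition poisson_map ::
  "(('p, 'm::finite) chart \<Rightarrow> 'p \<Rightarrow> real^'m^'m) \<Rightarrow> (('s, 2) chart \<Rightarrow> 's \<Rightarrow> real) \<Rightarrow> ('s \<Rightarrow> 'p)
     \<Rightarrow> ('s, 2) chart \<Rightarrow> ('p, 'm) chart \<Rightarrow> 's \<Rightarrow> real^'m \<Rightarrow> real^'m" where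
  "poisson_map G \<rho> \<iota> u x p X =
     (\<chi> i. \<Sum>k\<in>UNIV. \<Sum>j\<in>UNIV.
        poisson_bracket \<rho> u (emb_coord \<iota> x i) (emb_coord \<iota> x k) p * G x (\<iota> p) $ k $ j * X $ j)"

definition J_ambient ::
  "(('p, 'm::finite) chart \<Rightarrow> 'p \<Rightarrow> real^'m^'m) \<Rightarrow> (('s, 2) chart \<Rightarrow> 's \<Rightarrow> real) \<Rightarrow> ('s \<Rightarrow> 'p)
     \<Rightarrow> ('s, 2) chart \<Rightarrow> ('p, 'm) chart \<Rightarrow> 's \<Rightarrow> real^'m \<Rightarrow> real^'m" where
  "J_ambient G \<rho> \<iota> u x p X =
     (\<rho> u p / sqrt (det (induced_metric G \<iota> u x p))) *\<^sub>R poisson_map G \<rho> \<iota> u x p X"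

definition frame_components ::
  "('s \<Rightarrow> 'p) \<Rightarrow> ('s, 2) chart \<Rightarrow> ('p, 'm::finite) chart \<Rightarrow> 's \<Rightarrow> real^'m \<Rightarrow> real^2" where
  "frame_components \<iota> u x p X = (THE c. X = (\<Sum>b\<in>UNIV. c $ b *\<^sub>R frame \<iota> u x p b))"

text \<open>Meaningful only for \<open>X\<close> in the tangent plane.\<close>

definition J_surface ::
  "(('p, 'm::finite) chart \<Rightarrow> 'p \<Rightarrow> real^'m^'m) \<Rightarrow> ('s \<Rightarrow> 'p)
     \<Rightarrow> ('s, 2) chart \<Rightarrow> ('p, 'm) chart \<Rightarrow> 's \<Rightarrow> real^'m \<Rightarrow> real^'m" where
  "J_surface G \<iota> u x p X =
     (1 / sqrt (det (induced_metric G \<iota> u x p))) *\<^sub>R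
     (\<Sum>a\<in>UNIV. \<Sum>b\<in>UNIV. \<Sum>c\<in>UNIV.
        (eps a c * induced_metric G \<iota> u x p $ c $ b * frame_components \<iota> u x p X $ b)
          *\<^sub>R frame \<iota> u x p a)"

definition is_orthogonal_projection ::
  "('v \<Rightarrow> 'v \<Rightarrow> real) \<Rightarrow> 'v::real_vector set \<Rightarrow> 'v \<Rightarrow> 'v \<Rightarrow> bool" where
  "is_orthogonal_projection g T X Y \<longleftrightarrow> Y \<in> T \<and> (\<forall>Z\<in>T. g (X - Y) Z = 0)"

end

theory Submission
  imports Defs
begin

text \<open>Writing \<open>B\<close> for the ambient metric and \<open>e\<^sub>1, e\<^sub>2\<close> for the coordinate frame, the density cancels
  and the ambient map becomes \<open>X \<mapsto> (B(e\<^sub>2,X) e\<^sub>1 - B(e\<^sub>1,X) e\<^sub>2) / \<surd>g\<close>, where \<open>g\<close> is the Gram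
  determinant. On the tangent plane this is the complex structure, and the coefficients of its
  negated square are the cofactors of the Gram matrix divided by \<open>g\<close>, i.e. \<open>g\<^sup>a\<^sup>b\<close>. An embedding is
  an immersion, so the frame is linearly independent and \<open>g > 0\<close>.\<close>

section \<open>Differentiability of the embedding in charts and independence of the frame\<close>

lemma frechet_derivative_vec_nth:
  assumes "f differentiable at y"
  shows "frechet_derivative (\<lambda>z. f z $ i) (at y) h = frechet_derivative f (at y) h $ i"
proof -
  have "(f has_derivative frechet_derivative f (at y)) (at y)"
    using assms frechet_derivative_works by blast
  then have "((\<lambda>z. f z $ i) has_derivative (\<lambda>h. frechet_derivative f (at y) h $ i)) (at y)"
    by (rule bounded_linear.has_derivative[OF bounded_linear_vec_nth])
  from frechet_derivative_at[OF this] show ?thesis by metis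
qed

lemma smooth_on_imp_differentiable_at:
  assumes "smooth_on U f" "open U" "y \<in> U"
  shows "f differentiable at y"
proof -
  have "Ck_on (Suc 0) U f" using assms(1) unfolding smooth_on_def by blast
  then show ?thesis
    using assms(2,3) by (simp add: differentiable_on_eq_differentiable_at)
qed

lemma open_chart_image:
  assumes "chart_on S u" "openin S W"
  shows "open (snd u ` (fst u \<inter> W))"
proof -
  have u: "openin S (fst u)" "open (snd u ` fst u)"
    "homeomorphic_map (subtopology S (fst u)) (top_of_set (snd u ` fst u)) (snd u)"
    using assms(1) by (auto simp: chart_on_def)
  have "openin (subtopology S (fst u)) (fst u \<inter> W)"
    using assms(2) by (simp add: openin_subtopology_Int2)
  then have "openin (top_of_set (snd u ` fst u)) (snd u ` (fst u \<inter> W))"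
    using homeomorphic_imp_open_map[OF u(3)] by (simp add: open_map_def)
  then show ?thesis using u(2) openin_open_trans by blast
qed

text \<open>Smoothness of the embedding is assumed only on the part of the chart \<open>u\<close>
  that is sent into the chart \<open>x\<close>. Continuity of \<open>\<iota>\<close> makes this part
  open, so smoothness there yields a derivative at the point.\<close>

lemma differentiable_embedding_coords:
  assumes S: "smooth_manifold S AS" and M: "smooth_manifold M AM"
    and emb: "smooth_embedding S AS M AM \<iota>"
    and u: "chart_at AS p u" and x: "chart_at AM (\<iota> p) x"
  shows "in_coords u (snd x \<circ> \<iota>) differentiable at (snd u p)"
proof (rule smooth_on_imp_differentiable_at)
  have uA: "u \<in> AS" "p \<in> fst u" and xA: "x \<in> AM" "\<iota> p \<in> fst x"
    using u x by (auto simp: chart_at_def)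
  show "smooth_on (snd u ` (fst u \<inter> \<iota> -` fst x)) (in_coords u (snd x \<circ> \<iota>))"
    using emb uA xA by (auto simp: smooth_embedding_def)
  show "snd u p \<in> snd u ` (fst u \<inter> \<iota> -` fst x)" using uA xA by auto
  have cu: "chart_on S u" and "openin M (fst x)"
    using S M uA xA by (auto simp: smooth_manifold_def chart_on_def)
  moreover have "continuous_map S M \<iota>"
    using emb unfolding smooth_embedding_def embedding_map_def
    by (metis homeomorphic_imp_continuous_map continuous_map_in_subtopology)
  ultimately have W: "openin S {q \<in> topspace S. \<iota> q \<in> fst x}"
    by (simp add: openin_continuous_map_preimage)
  have "fst u \<subseteq> topspace S"
    using cu by (simp add: chart_on_def openin_subset)
  \<comment> \<open>The preimage is taken in the whole type, while openness is known for its part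
    inside \<open>topspace S\<close>. Within \<open>fst u\<close> the two agree.\<close>
  then have "fst u \<inter> \<iota> -` fst x = fst u \<inter> {q \<in> topspace S. \<iota> q \<in> fst x}" by auto
  then show "open (snd u ` (fst u \<inter> \<iota> -` fst x))"
    using open_chart_image[OF cu W] by simp
qed

text \<open>The frame is defined component by component; differentiability reassembles it into the
  differential of one vector-valued map, to which the immersion condition applies.\<close>

lemma frame_eq_frechet_derivative:
  assumes "in_coords u (snd x \<circ> \<iota>) differentiable at (snd u p)"
  shows "frame \<iota> u x p a = frechet_derivative (in_coords u (snd x \<circ> \<iota>)) (at (snd u p)) (axis a 1)"
proof -
  have "in_coords u (emb_coord \<iota> x i) = (\<lambda>y. in_coords u (snd x \<circ> \<iota>) y $ i)" for i
    by (simp add: in_coords_def emb_coord_def fun_eq_iff)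
  then show ?thesis
    by (simp add: vec_eq_iff frame_def coord_deriv_def pd_def frechet_derivative_vec_nth[OF assms])
qed

lemma frame_independent:
  assumes diff: "in_coords u (snd x \<circ> \<iota>) differentiable at (snd u p)"
    and inj: "inj (frechet_derivative (in_coords u (snd x \<circ> \<iota>)) (at (snd u p)))"
    and zero: "s *\<^sub>R frame \<iota> u x p 1 + t *\<^sub>R frame \<iota> u x p 2 = 0"
  shows "s = 0 \<and> t = 0"
proof -
  let ?F = "frechet_derivative (in_coords u (snd x \<circ> \<iota>)) (at (snd u p))"
  let ?v = "s *\<^sub>R axis 1 1 + t *\<^sub>R axis 2 1 :: real^2"
  have lin: "linear ?F" using diff by (rule linear_frechet_derivative)
  have "?F ?v = 0"
    using zero by (simp add: frame_eq_frechet_derivative[OF diff] linear_add[OF lin] linear_scale[OF lin])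
  then have "?v = 0" using inj lin by (simp add: linear_injective_0)
  then have "?v $ 1 = 0" "?v $ 2 = 0" by simp_all
  then show ?thesis by (simp add: axis_def)
qed

text \<open>Cramer's rule: the adjugate over the determinant is an inverse, and inverses are
  unique.\<close>

lemma matrix_inv_2:
  fixes A :: "real^2^2"
  assumes "det A \<noteq> 0"
  shows "matrix_inv A $ 1 $ 1 = A $ 2 $ 2 / det A" "matrix_inv A $ 1 $ 2 = - A $ 1 $ 2 / det A"
    "matrix_inv A $ 2 $ 1 = - A $ 2 $ 1 / det A" "matrix_inv A $ 2 $ 2 = A $ 1 $ 1 / det A"
proof -
  define C :: "real^2^2" where
    "C = vector [vector [A $ 2 $ 2 / det A, - A $ 1 $ 2 / det A],
                 vector [- A $ 2 $ 1 / det A, A $ 1 $ 1 / det A]]"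
  have "A ** C = mat 1"
    using assms by (simp add: C_def vec_eq_iff forall_2 matrix_matrix_mult_def sum_2 mat_def field_simps)
      (simp add: det_2 field_simps)
  moreover from this have "C ** A = mat 1" using matrix_left_right_inverse by blast
  \<comment> \<open>\<open>matrix_inv\<close> is a Hilbert choice, so it inverts \<open>A\<close>
    only once some two-sided inverse, here \<open>C\<close>, is known.\<close>
  ultimately have "A ** matrix_inv A = mat 1"
    unfolding matrix_inv_def by (metis (mono_tags, lifting) someI_ex)
  then have "C ** (A ** matrix_inv A) = C" by (simp add: matrix_mul_rid)
  then have "matrix_inv A = C"
    using \<open>C ** A = mat 1\<close> by (simp add: matrix_mul_assoc matrix_mul_lid)
  then show "matrix_inv A $ 1 $ 1 = A $ 2 $ 2 / det A" "matrix_inv A $ 1 $ 2 = - A $ 1 $ 2 / det A"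
    "matrix_inv A $ 2 $ 1 = - A $ 2 $ 1 / det A" "matrix_inv A $ 2 $ 2 = A $ 1 $ 1 / det A"
    by (simp_all add: C_def)
qed

section \<open>Gram determinants and quarter turns in a plane of an inner product space\<close>

definition gram :: "('v \<Rightarrow> 'v \<Rightarrow> real) \<Rightarrow> 'v \<Rightarrow> 'v \<Rightarrow> real" where
  "gram B v w = B v v * B w w - (B v w)\<^sup>2"

text \<open>For an inner product \<open>B\<close> and independent \<open>v\<close>,
  \<open>w\<close>, this is the orthogonal projection onto their plane followed by a quarter turn
  from \<open>w\<close> towards \<open>v\<close>.\<close>

definition turn :: "('v \<Rightarrow> 'v \<Rightarrow> real) \<Rightarrow> 'v \<Rightarrow> 'v \<Rightarrow> 'v \<Rightarrow> 'v::real_vector" where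
  "turn B v w X = (1 / sqrt (gram B v w)) *\<^sub>R (B w X *\<^sub>R v - B v X *\<^sub>R w)"

context
  fixes B :: "'v::real_vector \<Rightarrow> 'v \<Rightarrow> real" and v w :: 'v
  assumes bil: "bilinear B" and sym: "\<And>X Y. B X Y = B Y X" and pos: "\<And>X. X \<noteq> 0 \<Longrightarrow> 0 < B X X"
    and indep: "\<And>s t. s *\<^sub>R v + t *\<^sub>R w = 0 \<Longrightarrow> s = 0 \<and> t = 0"
begin

lemmas bilinear_expand = bilinear_ladd[OF bil] bilinear_radd[OF bil] bilinear_lmul[OF bil]
  bilinear_rmul[OF bil] bilinear_lsub[OF bil] bilinear_rsub[OF bil]

text \<open>The strict Cauchy-Schwarz inequality for independent vectors.\<close>

lemma gram_pos: "0 < gram B v w"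
proof -
  have "w \<noteq> 0" using indep[of 0 1] by auto
  then have ww: "0 < B w w" by (rule pos)
  \<comment> \<open>This is \<open>B w w\<close> times the component of \<open>v\<close> orthogonal
    to \<open>w\<close>.\<close>
  let ?y = "B w w *\<^sub>R v - B v w *\<^sub>R w"
  have "?y \<noteq> 0" using indep[of "B w w" "- B v w"] ww by auto
  then have "0 < B ?y ?y" by (rule pos)
  also have "B ?y ?y = B w w * gram B v w"
    by (simp add: bilinear_expand gram_def sym[of w v] power2_eq_square algebra_simps)
  finally show ?thesis using ww by (simp add: zero_less_mult_iff)
qed

lemma neg_turn_turn:
  "- turn B v w (turn B v w X) = ((B w w * B v X - B v w * B w X) / gram B v w) *\<^sub>R v
     + ((B v v * B w X - B v w * B v X) / gram B v w) *\<^sub>R w"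
proof -
  let ?r = "1 / sqrt (gram B v w)"
  \<comment> \<open>The square root enters only through this product, so both factors
    \<open>?r\<close> are collected before it is replaced.\<close>
  have r: "?r * ?r = 1 / gram B v w" using gram_pos by simp
  have "B w (turn B v w X) = ?r * (B w X * B v w - B v X * B w w)"
    "B v (turn B v w X) = ?r * (B w X * B v v - B v X * B v w)"
    by (simp_all add: turn_def bilinear_expand sym[of w v])
  then have "- turn B v w (turn B v w X) = - (?r *\<^sub>R ((?r * (B w X * B v w - B v X * B w w)) *\<^sub>R v
      - (?r * (B w X * B v v - B v X * B v w)) *\<^sub>R w))"
    by (simp only: turn_def[of B v w "turn B v w X"])
  also have "\<dots> = ((?r * ?r) * (B w w * B v X - B v w * B w X)) *\<^sub>R v
     + ((?r * ?r) * (B v v * B w X - B v w * B v X)) *\<^sub>R w"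
    by (simp only: scaleR_right_diff_distrib scaleR_scaleR) (simp add: algebra_simps)
  finally show ?thesis unfolding r by simp
qed

text \<open>The coefficients found above solve the normal equations, so the residual is orthogonal
  to \<open>v\<close> and \<open>w\<close>, hence to their span.\<close>

lemma is_orthogonal_projection_neg_turn_turn:
  "is_orthogonal_projection B (span {v, w}) X (- turn B v w (turn B v w X))"
  unfolding is_orthogonal_projection_def
proof (intro conjI ballI)
  have "v \<in> span {v, w}" "w \<in> span {v, w}" by (auto intro: span_base)
  then show "- turn B v w (turn B v w X) \<in> span {v, w}"
    unfolding neg_turn_turn by (intro span_add span_scale)
next
  fix Z assume "Z \<in> span {v, w}"
  then obtain s t where Z: "Z = s *\<^sub>R v + t *\<^sub>R w"
    by (auto simp: span_breakdown_eq algebra_simps eq_diff_eq)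
  have "gram B v w \<noteq> 0" using gram_pos by simp
  then have "B (X - - turn B v w (turn B v w X)) v = 0" "B (X - - turn B v w (turn B v w X)) w = 0"
    unfolding neg_turn_turn bilinear_expand sym[of w v] sym[of X v] sym[of X w]
    \<comment> \<open>Denominators are cleared while \<open>gram\<close> is still folded and known
      to be nonzero; only then is it expanded.\<close>
    by (simp_all add: field_simps) (simp_all add: gram_def power2_eq_square algebra_simps)
  then show "B (X - - turn B v w (turn B v w X)) Z = 0"
    by (simp add: Z bilinear_radd[OF bil] bilinear_rmul[OF bil])
qed

end

section \<open>The coordinate formulas expressed through \<open>gram\<close> and
  \<open>turn\<close>\<close>

lemma metric_at_eq_inner: "metric_at G x q X Y = X \<bullet> (G x q *v Y)"
  by (simp add: metric_at_def inner_vec_def matrix_vector_mult_def sum_distrib_left ac_simps)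

lemma bilinear_metric_at: "bilinear (metric_at G x q)"
  unfolding bilinear_def metric_at_eq_inner
  by (auto intro!: linearI simp: inner_add_left matrix_vector_right_distrib inner_add_right
      matrix_vector_mult_scaleR)

lemma metric_at_commute:
  assumes "transpose (G x q) = G x q"
  shows "metric_at G x q X Y = metric_at G x q Y X"
proof -
  have "X \<bullet> (G x q *v Y) = (transpose (G x q) *v X) \<bullet> Y"
    by (simp add: dot_lmul_matrix)
  then show ?thesis
    by (simp add: metric_at_eq_inner assms inner_commute)
qed

lemma det_induced_metric:
  assumes "transpose (G x (\<iota> p)) = G x (\<iota> p)"
  shows "det (induced_metric G \<iota> u x p) =
    gram (metric_at G x (\<iota> p)) (frame \<iota> u x p 1) (frame \<iota> u x p 2)"
  using metric_at_commute[of G x "\<iota> p", OF assms, of "frame \<iota> u x p 2" "frame \<iota> u x p 1"]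
  by (simp add: det_2 induced_metric_def gram_def power2_eq_square)

text \<open>Each bracket of coordinate functions is a two-by-two minor of the frame divided by the
  density. Contracting its second index with the metric and \<open>X\<close> leaves inner products
  of \<open>X\<close> with the frame.\<close>

lemma poisson_map_eq:
  "poisson_map G \<rho> \<iota> u x p X = (1 / \<rho> u p) *\<^sub>R
     (metric_at G x (\<iota> p) (frame \<iota> u x p 2) X *\<^sub>R frame \<iota> u x p 1
      - metric_at G x (\<iota> p) (frame \<iota> u x p 1) X *\<^sub>R frame \<iota> u x p 2)"
proof -
  let ?e = "frame \<iota> u x p" and ?G = "G x (\<iota> p)" and ?r = "1 / \<rho> u p"
  have "poisson_map G \<rho> \<iota> u x p X $ i =
    ?r * (metric_at G x (\<iota> p) (?e 2) X * ?e 1 $ i - metric_at G x (\<iota> p) (?e 1) X * ?e 2 $ i)" for i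
  proof -
    have "poisson_map G \<rho> \<iota> u x p X $ i = (\<Sum>k\<in>UNIV. \<Sum>j\<in>UNIV.
        ?r * (?G $ k $ j * ?e 2 $ k * X $ j * ?e 1 $ i - ?G $ k $ j * ?e 1 $ k * X $ j * ?e 2 $ i))"
      unfolding poisson_map_def vec_lambda_beta
    proof (intro sum.cong refl)
      fix k j
      have "poisson_bracket \<rho> u (emb_coord \<iota> x i) (emb_coord \<iota> x k) p
          = ?r * (?e 1 $ i * ?e 2 $ k - ?e 2 $ i * ?e 1 $ k)"
        by (simp add: poisson_bracket_def sum_2 eps_def frame_def)
      then show "poisson_bracket \<rho> u (emb_coord \<iota> x i) (emb_coord \<iota> x k) p * ?G $ k $ j * X $ j =
        ?r * (?G $ k $ j * ?e 2 $ k * X $ j * ?e 1 $ i - ?G $ k $ j * ?e 1 $ k * X $ j * ?e 2 $ i)"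
        by (simp only:) (simp add: algebra_simps)
    qed
    then show ?thesis
      by (simp only: metric_at_def sum_distrib_left[symmetric] sum_distrib_right[symmetric] sum_subtractf)
  qed
  then show ?thesis by (simp add: vec_eq_iff)
qed

lemma J_ambient_eq_turn:
  assumes "transpose (G x (\<iota> p)) = G x (\<iota> p)" "\<rho> u p \<noteq> 0"
  shows "J_ambient G \<rho> \<iota> u x p =
    turn (metric_at G x (\<iota> p)) (frame \<iota> u x p 1) (frame \<iota> u x p 2)"
  using assms(2)
  by (simp add: fun_eq_iff J_ambient_def poisson_map_eq turn_def
      det_induced_metric[of G x \<iota> p, OF assms(1)])

theorem theorem4p1:
  fixes M :: "'p topology" and AM :: "('p, 'm::finite) chart set"
    and gbar :: "('p, 'm) chart \<Rightarrow> 'p \<Rightarrow> real^'m^'m"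
    and S :: "'s topology" and AS :: "('s, 2) chart set"
    and \<iota> :: "'s \<Rightarrow> 'p" and \<rho> :: "('s, 2) chart \<Rightarrow> 's \<Rightarrow> real"
    and p :: 's and u :: "('s, 2) chart" and x :: "('p, 'm) chart"
  assumes "smooth_manifold M AM" and "riemannian_metric AM gbar"
    and "smooth_manifold S AS" and "smooth_embedding S AS M AM \<iota>"
    and "nonvanishing_density AS \<rho>"
    and "p \<in> topspace S" and "chart_at AS p u" and "chart_at AM (\<iota> p) x"
  shows "(\<forall>X \<in> tangent_plane \<iota> u x p.
            J_ambient gbar \<rho> \<iota> u x p X = J_surface gbar \<iota> u x p X) \<and>
         (\<forall>X.
           - J_ambient gbar \<rho> \<iota> u x p (J_ambient gbar \<rho> \<iota> u x p X) =
             (\<Sum>a\<in>UNIV. \<Sum>b\<in>UNIV.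
                (matrix_inv (induced_metric gbar \<iota> u x p) $ a $ b *
                 metric_at gbar x (\<iota> p) X (frame \<iota> u x p a)) *\<^sub>R frame \<iota> u x p b) \<and>
           is_orthogonal_projection (metric_at gbar x (\<iota> p)) (tangent_plane \<iota> u x p) X
             (- J_ambient gbar \<rho> \<iota> u x p (J_ambient gbar \<rho> \<iota> u x p X)))"
proof -
  let ?B = "metric_at gbar x (\<iota> p)" and ?e = "frame \<iota> u x p"
  let ?g = "induced_metric gbar \<iota> u x p" and ?J = "J_ambient gbar \<rho> \<iota> u x p"
  have u: "u \<in> AS" "p \<in> fst u" and x: "x \<in> AM" "\<iota> p \<in> fst x"
    using assms(7,8) by (auto simp: chart_at_def)
  have G: "transpose (gbar x (\<iota> p)) = gbar x (\<iota> p)"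
    "\<And>v. v \<noteq> 0 \<Longrightarrow> 0 < v \<bullet> (gbar x (\<iota> p) *v v)"
    using assms(2) x unfolding riemannian_metric_def by blast+
  have \<rho>: "\<rho> u p \<noteq> 0" using assms(5) u unfolding nonvanishing_density_def by blast
  have inj: "inj (frechet_derivative (in_coords u (snd x \<circ> \<iota>)) (at (snd u p)))"
    using assms(4) u x unfolding smooth_embedding_def by blast
  have diff: "in_coords u (snd x \<circ> \<iota>) differentiable at (snd u p)"
    by (rule differentiable_embedding_coords[OF assms(3,1,4,7,8)])
  note indep = frame_independent[OF diff inj]
  note bil = bilinear_metric_at[of gbar x "\<iota> p"]
  note sym = metric_at_commute[of gbar x "\<iota> p", OF G(1)]
  have pos: "\<And>v. v \<noteq> 0 \<Longrightarrow> 0 < ?B v v" using G(2) by (simp add: metric_at_eq_inner)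
  have J: "?J = turn ?B (?e 1) (?e 2)" by (rule J_ambient_eq_turn[of gbar x \<iota> p \<rho> u, OF G(1) \<rho>])
  have det: "det ?g = gram ?B (?e 1) (?e 2)" by (rule det_induced_metric[of gbar x \<iota> p, OF G(1)])
  have "0 < gram ?B (?e 1) (?e 2)" by (rule gram_pos[OF bil sym pos indep])
  then have det_nz: "det ?g \<noteq> 0" using det by simp
  have plane_eq: "tangent_plane \<iota> u x p = span {?e 1, ?e 2}"
    by (simp add: tangent_plane_def UNIV_2)
  have "?J X = J_surface gbar \<iota> u x p X" if "X \<in> tangent_plane \<iota> u x p" for X
  proof -
    obtain s t where X: "X = s *\<^sub>R ?e 1 + t *\<^sub>R ?e 2"
      using \<open>X \<in> tangent_plane \<iota> u x p\<close> unfolding plane_eq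
      by (auto simp: span_breakdown_eq algebra_simps eq_diff_eq)
    \<comment> \<open>The components are a definite description; independence of the frame supplies
      uniqueness.\<close>
    have "frame_components \<iota> u x p X = vector [s, t]"
      unfolding frame_components_def
    proof (rule the_equality)
      show "X = (\<Sum>b\<in>UNIV. (vector [s, t] :: real^2) $ b *\<^sub>R ?e b)" by (simp add: X sum_2)
    next
      fix c :: "real^2" assume "X = (\<Sum>b\<in>UNIV. c $ b *\<^sub>R ?e b)"
      then have "(c $ 1 - s) *\<^sub>R ?e 1 + (c $ 2 - t) *\<^sub>R ?e 2 = 0"
        by (simp add: X sum_2 algebra_simps)
      from indep[OF this] show "c = vector [s, t]" by (simp add: vec_eq_iff forall_2)
    qed
    \<comment> \<open>By bilinearity the products of frame vectors with \<open>X\<close> become the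
      metric applied to \<open>(s, t)\<close>; \<open>eps\<close> keeps the two signed terms of
      \<open>turn\<close>.\<close>
    then show ?thesis
      unfolding J turn_def J_surface_def det
      by (simp add: X sum_2 eps_def induced_metric_def bilinear_radd[OF bil] bilinear_rmul[OF bil]
          algebra_simps)
  qed
  moreover have "- ?J (?J X) =
      (\<Sum>a\<in>UNIV. \<Sum>b\<in>UNIV. (matrix_inv ?g $ a $ b * ?B X (?e a)) *\<^sub>R ?e b)" for X
    \<comment> \<open>The inverse metric becomes cofactors over \<open>gram\<close>, which are the
      coefficients in \<open>neg_turn_turn\<close> after regrouping by frame vectors.\<close>
    unfolding J sum_2 matrix_inv_2[OF det_nz] det sym[of X]
    by (rule trans[OF neg_turn_turn[OF bil sym pos indep]])
      (simp_all add: induced_metric_def sym[of "?e 2" "?e 1"] scaleR_left_distrib scaleR_left_diff_distrib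
        diff_divide_distrib)
  moreover have "is_orthogonal_projection ?B (tangent_plane \<iota> u x p) X (- ?J (?J X))" for X
    unfolding J plane_eq by (rule is_orthogonal_projection_neg_turn_turn[OF bil sym pos indep])
  ultimately show ?thesis by blast
qed

end
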